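(* Let $z$ be a real irrational number with negative regular continued fraction expansion $z=\lceil c_0,c_1,c_2,\ldots\rceil$, and let $s_j/t_j$, $j\ge 1$, be a $\lceil\ \rceil$-convergent of $z$. Then $s_j/t_j$ is a $\lfloor\ \rfloor$-convergent of $z$ if and only if $c_{j+1}\ge 3$. In particular, the sequence $s_j/t_j$, $j\ge 1$, contains infinitely many $\lfloor\ \rfloor$-convergents of $z$.
   Context: For real irrational $z$, the regular continued fraction expansion $z=\lfloor a_0,a_1,a_2,\ldots\rfloor$ is given by $z_0=z$, $a_0=\lfloor z_0\rfloor$, $z_{j+1}=1/(z_j-a_j)$, $a_{j+1}=\lfloor z_{j+1}\rfloor$; its convergents ($\lfloor\ \rfloor$-convergents) are $p_k/q_k$ with $p_{-1}=1,q_{-1}=0,p_0=a_0,q_0=1$, $p_{k+1}=a_{k+1}p_k+p_{k-1}$, $q_{k+1}=a_{k+1}q_k+q_{k-1}$. The negative regular continued fraction expansion $z=\lceil c_0,c_1,c_2,\ldots\rceil$, meaning $z=c_0-\cfrac{1}{c_1-\cfrac{1}{c_2-\cdots}}$, is given by $z_0=z$, $c_0=\lceil z_0\rceil$, $z_{j+1}=1/(c_j-z_j)$, $c_{j+1}=\lceil z_{j+1}\rceil$; its convergents ($\lceil\ \rceil$-convergents) are $s_j/t_j$ with $s_{-1}=1,t_{-1}=0,s_0=c_0,t_0=1$, $s_{j+1}=c_{j+1}s_j-s_{j-1}$, $t_{j+1}=c_{j+1}t_j-t_{j-1}$. *)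

theory Defs
  imports Complex_Main
begin

primrec floor_rem :: "real \<Rightarrow> nat \<Rightarrow> real" where
  "floor_rem z 0 = z"
| "floor_rem z (Suc j) = 1 / (floor_rem z j - of_int \<lfloor>floor_rem z j\<rfloor>)"

definition floor_digit :: "real \<Rightarrow> nat \<Rightarrow> int" where
  "floor_digit z j = \<lfloor>floor_rem z j\<rfloor>"

(* The convergent recursions below start at index 0.  The usual initial values at index -1
   (numerator 1, denominator 0) are built into the equations for index 1. *)

fun floor_num :: "real \<Rightarrow> nat \<Rightarrow> int" where
  "floor_num z 0 = floor_digit z 0"
| "floor_num z (Suc 0) = floor_digit z 1 * floor_digit z 0 + 1"
| "floor_num z (Suc (Suc k)) =
     floor_digit z (Suc (Suc k)) * floor_num z (Suc k) + floor_num z k"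

fun floor_den :: "real \<Rightarrow> nat \<Rightarrow> int" where
  "floor_den z 0 = 1"
| "floor_den z (Suc 0) = floor_digit z 1 * 1 + 0"
| "floor_den z (Suc (Suc k)) =
     floor_digit z (Suc (Suc k)) * floor_den z (Suc k) + floor_den z k"

definition floor_convergent :: "real \<Rightarrow> nat \<Rightarrow> real" where
  "floor_convergent z k = of_int (floor_num z k) / of_int (floor_den z k)"

(* The formal fraction 1/0 at index -1 is not included: as a real number, HOL would
   identify it with 0. *)
definition is_floor_convergent :: "real \<Rightarrow> real \<Rightarrow> bool" where
  "is_floor_convergent z x \<longleftrightarrow> (\<exists>k. x = floor_convergent z k)"

primrec ceil_rem :: "real \<Rightarrow> nat \<Rightarrow> real" where
  "ceil_rem z 0 = z"
| "ceil_rem z (Suc j) = 1 / (of_int \<lceil>ceil_rem z j\<rceil> - ceil_rem z j)"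

definition ceil_digit :: "real \<Rightarrow> nat \<Rightarrow> int" where
  "ceil_digit z j = \<lceil>ceil_rem z j\<rceil>"

fun ceil_num :: "real \<Rightarrow> nat \<Rightarrow> int" where
  "ceil_num z 0 = ceil_digit z 0"
| "ceil_num z (Suc 0) = ceil_digit z 1 * ceil_digit z 0 - 1"
| "ceil_num z (Suc (Suc j)) =
     ceil_digit z (Suc (Suc j)) * ceil_num z (Suc j) - ceil_num z j"

fun ceil_den :: "real \<Rightarrow> nat \<Rightarrow> int" where
  "ceil_den z 0 = 1"
| "ceil_den z (Suc 0) = ceil_digit z 1 * 1 - 0"
| "ceil_den z (Suc (Suc j)) =
     ceil_digit z (Suc (Suc j)) * ceil_den z (Suc j) - ceil_den z j"

definition ceil_convergent :: "real \<Rightarrow> nat \<Rightarrow> real" where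
  "ceil_convergent z j = of_int (ceil_num z j) / of_int (ceil_den z j)"

end

(* Write w = floor_rem z (2k+1), with p/q and p'/q' the floor convergents of index 2k and 2k-1.
   The ceiling convergents are exactly the intermediate fractions (p' + i p)/(q' + i q) with
   1 <= i <= floor w, and the following ceiling remainder is 1 + 1/(w - i).  For i < floor w it lies
   in (1,2), so the next digit is 2 and i increases by one; for i = floor w the fraction is the floor
   convergent of index 2k+1, and the next digit is 2 plus the floor digit of index 2k+2, hence >= 3.
   An intermediate fraction with i < floor w is not a floor convergent: it is in lowest terms,
   and its denominator lies strictly between two consecutive denominators of floor convergents. *)
theory Submission
  imports Defs
begin

section \<open>Floor expansion\<close>

lemma irrational_floor_rem: "z \<notin> \<rat> \<Longrightarrow> floor_rem z n \<notin> \<rat>"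
proof (induction n)
  case (Suc n)
  show ?case
  proof
    assume "floor_rem z (Suc n) \<in> \<rat>"
    then have "1 / floor_rem z (Suc n) + of_int \<lfloor>floor_rem z n\<rfloor> \<in> \<rat>"
      by (intro Rats_add Rats_divide) auto
    with Suc show False by simp
  qed
qed simp

text \<open>Irrationality rules out equality. With \<open>m\<close> equal to the floor, this keeps
  fractional parts nonzero, so their reciprocals are never 1/0.\<close>

lemma of_int_less_iff_le_floor:
  fixes x :: real
  assumes "x \<notin> \<rat>"
  shows "of_int m < x \<longleftrightarrow> m \<le> \<lfloor>x\<rfloor>"
  using assms by (metis Rats_of_int le_floor_iff order_less_le)

lemma floor_rem_gt_1:
  assumes "z \<notin> \<rat>"
  shows "floor_rem z (Suc n) > 1"
proof -
  have "of_int \<lfloor>floor_rem z n\<rfloor> < floor_rem z n"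
    using irrational_floor_rem[OF assms] by (simp add: of_int_less_iff_le_floor)
  moreover have "floor_rem z n < of_int \<lfloor>floor_rem z n\<rfloor> + 1" by linarith
  ultimately show ?thesis by (simp add: field_simps)
qed

lemma floor_digit_ge_1: "z \<notin> \<rat> \<Longrightarrow> floor_digit z (Suc n) \<ge> 1"
  using floor_rem_gt_1[of z n] by (simp add: floor_digit_def del: floor_rem.simps)

text \<open>The numerators and denominators with indices shifted by one, so that the initial values
  at index -1 are included.\<close>

definition floor_num' :: "real \<Rightarrow> nat \<Rightarrow> int" where
  "floor_num' z n = (case n of 0 \<Rightarrow> 1 | Suc m \<Rightarrow> floor_num z m)"

definition floor_den' :: "real \<Rightarrow> nat \<Rightarrow> int" where
  "floor_den' z n = (case n of 0 \<Rightarrow> 0 | Suc m \<Rightarrow> floor_den z m)"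

definition ceil_num' :: "real \<Rightarrow> nat \<Rightarrow> int" where
  "ceil_num' z n = (case n of 0 \<Rightarrow> 1 | Suc m \<Rightarrow> ceil_num z m)"

definition ceil_den' :: "real \<Rightarrow> nat \<Rightarrow> int" where
  "ceil_den' z n = (case n of 0 \<Rightarrow> 0 | Suc m \<Rightarrow> ceil_den z m)"

lemma floor_num'_simps:
  "floor_num' z 0 = 1"
  "floor_num' z (Suc 0) = floor_digit z 0"
  "floor_num' z (Suc (Suc n)) = floor_digit z (Suc n) * floor_num' z (Suc n) + floor_num' z n"
  by (cases n; simp add: floor_num'_def)+

lemma floor_den'_simps:
  "floor_den' z 0 = 0"
  "floor_den' z (Suc 0) = 1"
  "floor_den' z (Suc (Suc n)) = floor_digit z (Suc n) * floor_den' z (Suc n) + floor_den' z n"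
  by (cases n; simp add: floor_den'_def)+

lemma ceil_num'_simps:
  "ceil_num' z 0 = 1"
  "ceil_num' z (Suc 0) = ceil_digit z 0"
  "ceil_num' z (Suc (Suc n)) = ceil_digit z (Suc n) * ceil_num' z (Suc n) - ceil_num' z n"
  by (cases n; simp add: ceil_num'_def)+

lemma ceil_den'_simps:
  "ceil_den' z 0 = 0"
  "ceil_den' z (Suc 0) = 1"
  "ceil_den' z (Suc (Suc n)) = ceil_digit z (Suc n) * ceil_den' z (Suc n) - ceil_den' z n"
  by (cases n; simp add: ceil_den'_def)+

lemma floor_den_pos_mono:
  assumes "z \<notin> \<rat>"
  shows "floor_den z n > 0 \<and> floor_den z n \<le> floor_den z (Suc n)"
proof -
  \<comment> \<open>The induction starts at index -1, where the denominator is 0, so its first term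
    is only nonnegative. Growth is weak because a_1 = 1 gives q_0 = q_1.\<close>
  have "floor_den' z n \<ge> 0 \<and> floor_den' z (Suc n) > 0 \<and> floor_den' z (Suc n) \<le> floor_den' z (Suc (Suc n))"
  proof (induction n)
    case 0
    then show ?case using floor_digit_ge_1[OF assms, of 0] by (simp add: floor_den'_simps)
  next
    case (Suc n)
    have "1 * floor_den' z (Suc (Suc n)) \<le> floor_digit z (Suc (Suc n)) * floor_den' z (Suc (Suc n))"
      by (rule mult_right_mono) (use Suc floor_digit_ge_1[OF assms, of "Suc n"] in linarith)+
    with Suc show ?case unfolding floor_den'_simps(3)[of z "Suc n"] by linarith
  qed
  then show ?thesis by (simp add: floor_den'_def)
qed

lemmas floor_den_pos = floor_den_pos_mono[THEN conjunct1]

lemma floor_den_mono: "z \<notin> \<rat> \<Longrightarrow> m \<le> n \<Longrightarrow> floor_den z m \<le> floor_den z n"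
  using floor_den_pos_mono lift_Suc_mono_le by blast

section \<open>Lowest terms\<close>

lemma coprime_if_det_unit:
  fixes a b c d :: int
  assumes "\<bar>a * d - b * c\<bar> = 1"
  shows "coprime a c"
proof (rule coprimeI)
  fix e assume "e dvd a" "e dvd c"
  then have "e dvd a * d - b * c" by (simp add: dvd_diff)
  then show "is_unit e" using assms by (metis abs_dvd_iff dvd_abs_iff)
qed

lemma floor_num_den_coprime: "coprime (floor_num z n) (floor_den z n)"
proof -
  \<comment> \<open>The determinant of consecutive convergents changes sign at each step; the
    absolute value absorbs this.\<close>
  have "\<bar>floor_num' z (Suc n) * floor_den' z n - floor_num' z n * floor_den' z (Suc n)\<bar> = 1"
  proof (induction n)
    case (Suc n)
    then show ?case
      by (simp add: floor_num'_simps(3) floor_den'_simps(3) algebra_simps abs_minus_commute)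
  qed (simp add: floor_num'_simps floor_den'_simps)
  from coprime_if_det_unit[OF this] show ?thesis
    by (simp add: floor_num'_def floor_den'_def)
qed

lemma ceil_num_den_coprime: "coprime (ceil_num z n) (ceil_den z n)"
proof -
  have "\<bar>ceil_num' z (Suc n) * ceil_den' z n - ceil_num' z n * ceil_den' z (Suc n)\<bar> = 1"
  proof (induction n)
    case (Suc n)
    then show ?case
      by (simp add: ceil_num'_simps(3) ceil_den'_simps(3) algebra_simps)
  qed (simp add: ceil_num'_simps ceil_den'_simps)
  from coprime_if_det_unit[OF this] show ?thesis
    by (simp add: ceil_num'_def ceil_den'_def)
qed

text \<open>After cross-multiplication, coprimality makes each positive denominator divide the
  other. This reduces comparing convergents to comparing denominators.\<close>

lemma lowest_terms_den_unique:
  fixes a b c d :: int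
  assumes "coprime a b" "coprime c d" "b > 0" "d > 0"
    and eq: "(of_int a / of_int b :: real) = of_int c / of_int d"
  shows "b = d"
proof -
  have "(of_int (a * d) :: real) = of_int (c * b)"
    using eq assms(3,4) by (simp add: field_simps)
  then have eq': "a * d = c * b" by (simp only: of_int_eq_iff)
  then have "b dvd a * d" "d dvd c * b" by (metis dvd_triv_right)+
  then have "b dvd d" "d dvd b"
    using assms(1,2) by (simp_all add: coprime_dvd_mult_right_iff coprime_commute)
  then show ?thesis using assms(3,4) by (simp add: zdvd_antisym_nonneg)
qed

section \<open>Ceiling convergents as intermediate fractions\<close>

text \<open>Because of the index shift, \<^term>\<open>floor_num' z (2 * k)\<close> has index \<open>2 * k - 1\<close>,
  while the remainder and digit of index \<open>2 * k + 1\<close> are not shifted.\<close>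

definition intermediate :: "real \<Rightarrow> nat \<Rightarrow> nat \<Rightarrow> int \<Rightarrow> bool" where
  "intermediate z j k i \<longleftrightarrow>
     1 \<le> i \<and> i \<le> floor_digit z (2 * k + 1) \<and>
     ceil_num' z (Suc j) = floor_num' z (2 * k) + i * floor_num' z (2 * k + 1) \<and>
     ceil_den' z (Suc j) = floor_den' z (2 * k) + i * floor_den' z (2 * k + 1) \<and>
     ceil_num' z (Suc j) - ceil_num' z j = floor_num' z (2 * k + 1) \<and>
     ceil_den' z (Suc j) - ceil_den' z j = floor_den' z (2 * k + 1) \<and>
     ceil_rem z (Suc j) = 1 + 1 / (floor_rem z (2 * k + 1) - of_int i)"

text \<open>If f is the fractional part of \<open>floor_rem z n\<close>, then 1/(1 - f) = 1 + 1/(1/f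
  - 1). This produces the remainder for \<open>i = 1\<close> at the start of each block of constant
  \<open>k\<close>.\<close>

lemma ceil_rem_after_floor_step:
  assumes "z \<notin> \<rat>" "c = of_int \<lfloor>floor_rem z n\<rfloor> + 1"
  shows "1 / (c - floor_rem z n) = 1 + 1 / (floor_rem z (Suc n) - 1)"
proof -
  have "of_int \<lfloor>floor_rem z n\<rfloor> < floor_rem z n"
    using irrational_floor_rem[OF assms(1)] by (simp add: of_int_less_iff_le_floor)
  moreover have "floor_rem z n < of_int \<lfloor>floor_rem z n\<rfloor> + 1" by linarith
  ultimately show ?thesis by (simp add: assms(2) field_simps)
qed

lemma intermediate_0:
  assumes "z \<notin> \<rat>"
  shows "intermediate z 0 0 1"
proof -
  have "of_int \<lfloor>z\<rfloor> < z" using assms by (simp add: of_int_less_iff_le_floor)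
  then have c: "\<lceil>z\<rceil> = \<lfloor>z\<rfloor> + 1" by linarith
  have "ceil_rem z (Suc 0) = 1 + 1 / (floor_rem z (Suc 0) - 1)"
    using ceil_rem_after_floor_step[OF assms, of _ 0] c by simp
  then show ?thesis
    using floor_digit_ge_1[OF assms, of 0] c
    by (simp add: intermediate_def floor_num'_simps floor_den'_simps ceil_num'_simps
        ceil_den'_simps ceil_digit_def floor_digit_def del: ceil_rem.simps floor_rem.simps)
      (simp add: c)
qed

text \<open>Here w - i > 1 forces the digit 2. The recursion then reads s_{j+1} - s_j = s_j -
  s_{j-1}, so the recorded difference p_{2k} is added once more; denominators behave alike.\<close>

lemma intermediate_step_inner:
  assumes z: "z \<notin> \<rat>" and I: "intermediate z j k i" and lt: "i < floor_digit z (2 * k + 1)"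
  shows "ceil_digit z (Suc j) = 2 \<and> intermediate z (Suc j) k (i + 1)"
proof -
  define w where "w = floor_rem z (2 * k + 1)"
  have "of_int (i + 1) < w"
    using lt irrational_floor_rem[OF z] unfolding w_def floor_digit_def
    by (subst of_int_less_iff_le_floor) (auto simp del: floor_rem.simps)
  then have w: "w - of_int i > 1" by simp
  have y: "ceil_rem z (Suc j) = 1 + 1 / (w - of_int i)"
    using I unfolding intermediate_def w_def by blast
  have c: "ceil_digit z (Suc j) = 2"
    unfolding ceil_digit_def y by (rule ceiling_unique) (use w in \<open>auto simp: field_simps\<close>)
  have "ceil_rem z (Suc (Suc j)) = 1 / (2 - (1 + 1 / (w - of_int i)))"
    using c unfolding ceil_digit_def ceil_rem.simps(2)[of z "Suc j"] y by simp
  also have "\<dots> = 1 + 1 / (w - of_int (i + 1))"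
    using w by (simp add: field_simps)
  finally show ?thesis
    using I c lt
    by (simp add: intermediate_def w_def ceil_num'_simps(3) ceil_den'_simps(3) algebra_simps
        del: ceil_rem.simps floor_rem.simps)
qed

text \<open>Now w - i is the fractional part of w, so its reciprocal is the next floor remainder;
  the ceiling of 1 plus that remainder is a_{2k+2} + 2.\<close>

lemma intermediate_step_last:
  assumes z: "z \<notin> \<rat>" and I: "intermediate z j k (floor_digit z (2 * k + 1))"
  shows "ceil_digit z (Suc j) \<ge> 3 \<and> intermediate z (Suc j) (Suc k) 1"
proof -
  define n where "n = 2 * k + 1"
  have nk: "2 * Suc k = Suc n" unfolding n_def by simp
  have y: "ceil_rem z (Suc j) = 1 + floor_rem z (Suc n)"
    using I by (simp add: intermediate_def n_def floor_digit_def del: ceil_rem.simps)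
  have "of_int \<lfloor>floor_rem z (Suc n)\<rfloor> < floor_rem z (Suc n)"
    using irrational_floor_rem[OF z] by (simp add: of_int_less_iff_le_floor del: floor_rem.simps)
  then have c: "ceil_digit z (Suc j) = floor_digit z (Suc n) + 2"
    unfolding ceil_digit_def floor_digit_def y by linarith
  have "ceil_rem z (Suc (Suc j)) = 1 / (of_int (floor_digit z (Suc n)) + 1 - floor_rem z (Suc n))"
    using c unfolding ceil_digit_def ceil_rem.simps(2)[of z "Suc j"] y by (simp add: algebra_simps)
  also have "\<dots> = 1 + 1 / (floor_rem z (Suc (Suc n)) - 1)"
    by (rule ceil_rem_after_floor_step[OF z]) (simp add: floor_digit_def)
  finally have r: "ceil_rem z (Suc (Suc j)) = 1 + 1 / (floor_rem z (Suc (Suc n)) - 1)" .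
  have num: "ceil_num' z (Suc j) = floor_num' z (Suc n)"
    "ceil_num' z (Suc j) - ceil_num' z j = floor_num' z n"
    and den: "ceil_den' z (Suc j) = floor_den' z (Suc n)"
    "ceil_den' z (Suc j) - ceil_den' z j = floor_den' z n"
    using I unfolding intermediate_def n_def
    by (simp_all add: floor_num'_simps(3) floor_den'_simps(3) del: ceil_rem.simps floor_rem.simps)
  \<comment> \<open>Write a for a_{2k+2}. Then (a + 2) s_j - s_{j-1} = s_j + (a s_j + (s_j -
    s_{j-1})), and the bracket is a p_{2k+1} + p_{2k} = p_{2k+2}.\<close>
  have "ceil_num' z (Suc (Suc j)) = floor_num' z (Suc n) + floor_num' z (Suc (Suc n))"
    "ceil_den' z (Suc (Suc j)) = floor_den' z (Suc n) + floor_den' z (Suc (Suc n))"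
    using num den c
    by (simp_all add: ceil_num'_simps(3) ceil_den'_simps(3) floor_num'_simps(3)[of z n]
        floor_den'_simps(3)[of z n] algebra_simps)
  then have "intermediate z (Suc j) (Suc k) 1"
    using num den r floor_digit_ge_1[OF z, of "Suc n"]
    unfolding intermediate_def nk by (simp del: ceil_rem.simps floor_rem.simps)
  moreover have "ceil_digit z (Suc j) \<ge> 3" using c floor_digit_ge_1[OF z, of n] by simp
  ultimately show ?thesis by blast
qed

lemma intermediate_exists:
  assumes "z \<notin> \<rat>"
  obtains k i where "intermediate z j k i"
proof -
  have "\<exists>k i. intermediate z j k i"
  proof (induction j)
    case 0
    show ?case using intermediate_0[OF assms] by blast
  next
    case (Suc j)
    then obtain k i where I: "intermediate z j k i" by blast
    then have "i \<le> floor_digit z (2 * k + 1)" by (simp add: intermediate_def)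
    then show ?case
      using I intermediate_step_inner[OF assms I] intermediate_step_last[OF assms, of j k]
      by (metis order_le_less)
  qed
  then show ?thesis using that by blast
qed

text \<open>Inner steps keep \<open>k\<close> and raise \<open>i\<close> by one, so the distance of
  \<open>i\<close> to the floor digit decreases until the block ends.\<close>

lemma intermediate_reaches_last:
  assumes "z \<notin> \<rat>" "intermediate z j k i"
  shows "\<exists>j'\<ge>j. intermediate z j' k (floor_digit z (2 * k + 1))"
  using assms(2)
proof (induction "nat (floor_digit z (2 * k + 1) - i)" arbitrary: i j rule: less_induct)
  case less
  show ?case
  proof (cases "i < floor_digit z (2 * k + 1)")
    case True
    with less.hyps[of "i + 1" "Suc j"] intermediate_step_inner[OF assms(1) less.prems]
    show ?thesis by (metis Suc_leD nat_mono_iff diff_gt_0_iff_gt diff_strict_left_mono zless_add1_eq)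
  next
    case False
    with less.prems have "i = floor_digit z (2 * k + 1)" by (simp add: intermediate_def)
    with less.prems show ?thesis by blast
  qed
qed

section \<open>Comparison of the convergents\<close>

lemma strict_mono_ceil_den':
  assumes "z \<notin> \<rat>"
  shows "strict_mono (ceil_den' z)"
  unfolding strict_mono_Suc_iff
proof
  fix j
  obtain k i where "intermediate z j k i" using intermediate_exists[OF assms] .
  then have "ceil_den' z (Suc j) - ceil_den' z j = floor_den z (2 * k)"
    by (simp add: intermediate_def floor_den'_def)
  then show "ceil_den' z j < ceil_den' z (Suc j)"
    using floor_den_pos[OF assms, of "2 * k"] by simp
qed

lemma strict_mono_ceil_den: "z \<notin> \<rat> \<Longrightarrow> strict_mono (ceil_den z)"
  using strict_mono_ceil_den'[THEN strict_monoD, of z "Suc _" "Suc _"]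
  by (auto simp: ceil_den'_def intro: strict_monoI)

lemma ceil_den_pos: "z \<notin> \<rat> \<Longrightarrow> ceil_den z j > 0"
  using strict_mono_ceil_den'[THEN strict_monoD, of z 0 "Suc j"] by (simp add: ceil_den'_def)

text \<open>Equal values in lowest terms have equal denominators, and these strictly increase. Hence
  infinitely many indices give infinitely many values.\<close>

lemma inj_ceil_convergent:
  assumes "z \<notin> \<rat>"
  shows "inj (ceil_convergent z)"
proof (rule injI)
  fix i j assume "ceil_convergent z i = ceil_convergent z j"
  then have "ceil_den z i = ceil_den z j"
    unfolding ceil_convergent_def
    by (intro lowest_terms_den_unique[OF ceil_num_den_coprime ceil_num_den_coprime])
      (use ceil_den_pos[OF assms] in auto)
  then show "i = j" using strict_mono_ceil_den[OF assms] by (simp add: strict_mono_eq)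
qed

lemma is_floor_convergent_if_last:
  assumes "intermediate z j k (floor_digit z (2 * k + 1))"
  shows "is_floor_convergent z (ceil_convergent z j)"
proof -
  have "ceil_num' z (Suc j) = floor_num' z (Suc (Suc (2 * k)))"
    "ceil_den' z (Suc j) = floor_den' z (Suc (Suc (2 * k)))"
    using assms unfolding intermediate_def
    by (simp_all add: floor_num'_simps(3) floor_den'_simps(3) del: ceil_rem.simps floor_rem.simps)
  then have "ceil_convergent z j = floor_convergent z (Suc (2 * k))"
    by (simp add: ceil_convergent_def floor_convergent_def ceil_num'_def ceil_den'_def
        floor_num'_def floor_den'_def)
  then show ?thesis unfolding is_floor_convergent_def by blast
qed

text \<open>For \<open>j = 0\<close> the denominator is \<open>1\<close>, and the lower bound used here fails.\<close>

lemma not_is_floor_convergent_if_inner: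
  assumes z: "z \<notin> \<rat>" and I: "intermediate z j k i" and lt: "i < floor_digit z (2 * k + 1)"
    and j: "j \<ge> 1"
  shows "\<not> is_floor_convergent z (ceil_convergent z j)"
proof
  assume "is_floor_convergent z (ceil_convergent z j)"
  then obtain m where "ceil_convergent z j = floor_convergent z m"
    unfolding is_floor_convergent_def by blast
  then have eq: "ceil_den z j = floor_den z m"
    unfolding ceil_convergent_def floor_convergent_def
    by (intro lowest_terms_den_unique[OF ceil_num_den_coprime floor_num_den_coprime])
      (use ceil_den_pos[OF z] floor_den_pos[OF z] in auto)
  obtain l where l: "j = Suc l" using j by (cases j) auto
  have "ceil_den z j - ceil_den z l = floor_den z (2 * k)"
    using I by (simp add: l intermediate_def ceil_den'_def floor_den'_def)
  then have lower: "floor_den z (2 * k) < ceil_den z j" using ceil_den_pos[OF z, of l] by simp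
  have "ceil_den z j = floor_den' z (2 * k) + i * floor_den z (2 * k)"
    using I by (simp add: intermediate_def ceil_den'_def floor_den'_def)
  also have "\<dots> < floor_den' z (2 * k) + floor_digit z (2 * k + 1) * floor_den z (2 * k)"
    using lt floor_den_pos[OF z] by simp
  also have "\<dots> = floor_den z (Suc (2 * k))"
    using floor_den'_simps(3)[of z "2 * k"] by (simp add: floor_den'_def)
  finally have upper: "ceil_den z j < floor_den z (Suc (2 * k))" .
  \<comment> \<open>By monotonicity no floor denominator lies strictly between q_{2k} and q_{2k+1}:
    it is at most the former if m is at most 2k, and at least the latter otherwise.\<close>
  show False
    using lower upper eq floor_den_mono[OF z, of m "2 * k"] floor_den_mono[OF z, of "Suc (2 * k)" m]
    by (cases "m \<le> 2 * k") auto
qed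

lemma infinite_ceil_digit_ge_3:
  assumes "z \<notin> \<rat>"
  shows "infinite {j. j \<ge> 1 \<and> ceil_digit z (j + 1) \<ge> 3}"
proof -
  have "\<exists>n\<ge>m. n \<in> {j. j \<ge> 1 \<and> ceil_digit z (j + 1) \<ge> 3}" for m
  proof -
    \<comment> \<open>Starting at \<open>Suc m\<close> makes the end of the block both exceed
      \<open>m\<close> and satisfy \<open>j \<ge> 1\<close>.\<close>
    obtain k i where "intermediate z (Suc m) k i" using intermediate_exists[OF assms] .
    then obtain j where "j \<ge> Suc m" "intermediate z j k (floor_digit z (2 * k + 1))"
      using intermediate_reaches_last[OF assms] by blast
    then show ?thesis
      using intermediate_step_last[OF assms] by (intro exI[of _ j]) auto
  qed
  then show ?thesis by (metis finite_nat_set_iff_bounded linorder_not_le)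
qed

theorem theorem1:
  fixes z :: real
  assumes "z \<notin> \<rat>"
  shows "(\<forall>j\<ge>1. is_floor_convergent z (ceil_convergent z j) \<longleftrightarrow> ceil_digit z (j + 1) \<ge> 3)
    \<and> infinite {x. (\<exists>j\<ge>1. x = ceil_convergent z j) \<and> is_floor_convergent z x}"
proof
  show iff: "\<forall>j\<ge>1. is_floor_convergent z (ceil_convergent z j) \<longleftrightarrow> ceil_digit z (j + 1) \<ge> 3"
  proof (intro allI impI)
    fix j :: nat assume j: "j \<ge> 1"
    obtain k i where I: "intermediate z j k i" using intermediate_exists[OF assms] .
    show "is_floor_convergent z (ceil_convergent z j) \<longleftrightarrow> ceil_digit z (j + 1) \<ge> 3"
    proof (cases "i < floor_digit z (2 * k + 1)")
      case True
      then show ?thesis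
        using not_is_floor_convergent_if_inner[OF assms I True j]
          intermediate_step_inner[OF assms I True] by simp
    next
      case False
      with I have "intermediate z j k (floor_digit z (2 * k + 1))"
        by (metis intermediate_def order_le_less)
      then show ?thesis
        using is_floor_convergent_if_last intermediate_step_last[OF assms] by simp
    qed
  qed
  have "infinite (ceil_convergent z ` {j. j \<ge> 1 \<and> ceil_digit z (j + 1) \<ge> 3})"
    using infinite_ceil_digit_ge_3[OF assms] inj_ceil_convergent[OF assms]
    by (metis finite_imageD inj_on_subset subset_UNIV)
  then show "infinite {x. (\<exists>j\<ge>1. x = ceil_convergent z j) \<and> is_floor_convergent z x}"
    by (rule infinite_super[rotated]) (use iff in auto)
qed

end
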